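(* Let $n \geq 4$ be an integer, let $v$ be a vertex of the complete graph $K_n$, and let $H_n$ be the graph obtained from $K_n$ by subdividing once every edge incident with $v$. Then $H_n$ is $(n+1)$-critical but $H_n$ is not $1$-unique; moreover, $v$ is the only vertex of $H_n$ that is not $1$-unique in $H_n$.
   Context: Graphs are finite and simple. For a graph $G$ and a positive integer $k$, a $k$-ranking of $G$ is a labeling of the vertices of $G$ with labels from $\{1,\dots,k\}$ such that every path in $G$ joining two distinct vertices with the same label contains a vertex with a larger label. The tree-depth $\operatorname{td}(G)$ is the smallest $k$ for which a $k$-ranking of $G$ exists. A ranking of $G$ is optimal if it is a $\operatorname{td}(G)$-ranking. The graph $G$ is critical if every proper minor of $G$ has tree-depth less than $\operatorname{td}(G)$, and $k$-critical if it is critical and $\operatorname{td}(G)=k$. (A proper minor of $G$ is a graph obtained from $G$ by a nonempty sequence of vertex deletions, edge deletions and edge contractions, with loops and multiple edges suppressed.) A vertex $u$ of $G$ is $1$-unique in $G$ if there is an optimal ranking of $G$ in which $u$ is the only vertex receiving label $1$. The graph $G$ is $1$-unique if every vertex of $G$ is $1$-unique in $G$. Subdividing an edge $xy$ once means replacing it by a path $x, z, y$ through a new vertex $z$ of degree $2$. *)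

theory Defs
  imports Main
begin

section \<open>Finite simple graphs\<close>

record 'a graph =
  verts :: "'a set"
  edges :: "'a set set"

definition simple_graph :: "'a graph \<Rightarrow> bool" where
  "simple_graph G \<longleftrightarrow> finite (verts G) \<and> (\<forall>e\<in>edges G. e \<subseteq> verts G \<and> card e = 2)"

definition is_path :: "'a graph \<Rightarrow> 'a list \<Rightarrow> bool" where
  "is_path G p \<longleftrightarrow> p \<noteq> [] \<and> set p \<subseteq> verts G \<and> distinct p
     \<and> successively (\<lambda>x y. {x, y} \<in> edges G) p"


section \<open>Rankings and tree-depth\<close>

text \<open>Only the values of the labeling \<open>f\<close> on the vertices of \<open>G\<close> matter.\<close>

definition is_ranking :: "'a graph \<Rightarrow> nat \<Rightarrow> ('a \<Rightarrow> nat) \<Rightarrow> bool" where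
  "is_ranking G k f \<longleftrightarrow>
     (\<forall>x\<in>verts G. f x \<in> {1..k}) \<and>
     (\<forall>p. is_path G p \<and> hd p \<noteq> last p \<and> f (hd p) = f (last p)
          \<longrightarrow> (\<exists>z\<in>set p. f z > f (hd p)))"

text \<open>
  A graph with at least one vertex has no 0-ranking, so for such graphs the minimum is over
  positive \<open>k\<close>; the graph without vertices has tree-depth 0.
\<close>

definition tree_depth :: "'a graph \<Rightarrow> nat" where
  "tree_depth G = (LEAST k. \<exists>f. is_ranking G k f)"

definition optimal_ranking :: "'a graph \<Rightarrow> ('a \<Rightarrow> nat) \<Rightarrow> bool" where
  "optimal_ranking G f \<longleftrightarrow> is_ranking G (tree_depth G) f"

definition one_unique_vertex :: "'a graph \<Rightarrow> 'a \<Rightarrow> bool" where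
  "one_unique_vertex G u \<longleftrightarrow>
     u \<in> verts G \<and> (\<exists>f. optimal_ranking G f \<and> {x \<in> verts G. f x = 1} = {u})"

definition one_unique :: "'a graph \<Rightarrow> bool" where
  "one_unique G \<longleftrightarrow> (\<forall>u\<in>verts G. one_unique_vertex G u)"


section \<open>Minors and criticality\<close>

definition delete_vertex :: "'a graph \<Rightarrow> 'a \<Rightarrow> 'a graph" where
  "delete_vertex G x = \<lparr>verts = verts G - {x}, edges = {e \<in> edges G. x \<notin> e}\<rparr>"

definition delete_edge :: "'a graph \<Rightarrow> 'a set \<Rightarrow> 'a graph" where
  "delete_edge G e = \<lparr>verts = verts G, edges = edges G - {e}\<rparr>"

text \<open>
  Contraction of the edge \<open>{x, y}\<close>: the merged vertex keeps the name \<open>x\<close>. The condition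
  \<open>card e = 2\<close> removes the loop that arises, and parallel edges coincide as sets.
\<close>

definition contract_edge :: "'a graph \<Rightarrow> 'a \<Rightarrow> 'a \<Rightarrow> 'a graph" where
  "contract_edge G x y =
     \<lparr>verts = verts G - {y},
      edges = {e \<in> (\<lambda>e. (\<lambda>z. if z = y then x else z) ` e) ` edges G. card e = 2}\<rparr>"

inductive minor_step :: "'a graph \<Rightarrow> 'a graph \<Rightarrow> bool" where
  vertex_deletion: "x \<in> verts G \<Longrightarrow> minor_step G (delete_vertex G x)"
| edge_deletion: "e \<in> edges G \<Longrightarrow> minor_step G (delete_edge G e)"
| edge_contraction: "{x, y} \<in> edges G \<Longrightarrow> minor_step G (contract_edge G x y)"

definition proper_minor :: "'a graph \<Rightarrow> 'a graph \<Rightarrow> bool" where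
  "proper_minor M G \<longleftrightarrow> minor_step\<^sup>+\<^sup>+ G M"

definition critical :: "'a graph \<Rightarrow> bool" where
  "critical G \<longleftrightarrow> (\<forall>M. proper_minor M G \<longrightarrow> tree_depth M < tree_depth G)"

definition k_critical :: "nat \<Rightarrow> 'a graph \<Rightarrow> bool" where
  "k_critical k G \<longleftrightarrow> critical G \<and> tree_depth G = k"


section \<open>Complete graphs and subdivisions\<close>

definition complete_graph :: "'a set \<Rightarrow> 'a graph" where
  "complete_graph V = \<lparr>verts = V, edges = {e. e \<subseteq> V \<and> card e = 2}\<rparr>"

text \<open>
  Subdivide each edge in \<open>F\<close> once: \<open>Inl x\<close> is the old vertex \<open>x\<close>, and \<open>Inr e\<close> is the new
  vertex in the middle of the edge \<open>e\<close>.
\<close>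

definition subdivide_edges :: "'a graph \<Rightarrow> 'a set set \<Rightarrow> ('a + 'a set) graph" where
  "subdivide_edges G F =
     \<lparr>verts = Inl ` verts G \<union> Inr ` F,
      edges = (\<lambda>e. Inl ` e) ` (edges G - F) \<union> {{Inl x, Inr e} | x e. e \<in> F \<and> x \<in> e}\<rparr>"

definition subdivide_at :: "'a graph \<Rightarrow> 'a \<Rightarrow> ('a + 'a set) graph" where
  "subdivide_at G v = subdivide_edges G {e \<in> edges G. v \<in> e}"


section \<open>The constructions stay within finite simple graphs\<close>

lemma simple_graph_complete: "finite V \<Longrightarrow> simple_graph (complete_graph V)"
  by (simp add: simple_graph_def complete_graph_def)

lemma simple_graph_subdivide_edges:
  assumes "simple_graph G" "F \<subseteq> edges G"
  shows "simple_graph (subdivide_edges G F)"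
proof -
  have "edges G \<subseteq> Pow (verts G)" "finite (verts G)"
    using assms(1) by (auto simp: simple_graph_def)
  then have "finite F"
    using assms(2) by (meson finite_Pow_iff finite_subset)
  then show ?thesis
    using assms by (fastforce simp: simple_graph_def subdivide_edges_def card_image)
qed

lemma simple_graph_subdivide_at: "simple_graph G \<Longrightarrow> simple_graph (subdivide_at G v)"
  by (simp add: subdivide_at_def simple_graph_subdivide_edges)

lemma simple_graph_minor_step: "minor_step G M \<Longrightarrow> simple_graph G \<Longrightarrow> simple_graph M"
proof (induction rule: minor_step.induct)
  case (vertex_deletion x G)
  then show ?case by (auto simp: simple_graph_def delete_vertex_def)
next
  case (edge_deletion e G)
  then show ?case by (auto simp: simple_graph_def delete_edge_def)
next
  case (edge_contraction x y G)
  then have "x \<in> verts G" "x \<noteq> y"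
    by (auto simp: simple_graph_def card_2_iff)
  with edge_contraction show ?case
    by (auto simp: simple_graph_def contract_edge_def split: if_splits)
qed

end

theory Submission
  imports Defs
begin

text \<open>
  Write \<open>H\<close> for the subdivided graph. It consists of the hub \<open>v\<close>, a clique \<open>C\<close> on the other
  \<open>n - 1\<close> vertices, and for each clique vertex a middle vertex joined to it and to the hub; these
  three-vertex paths are called spokes.

  Upper bounds. Give distinct high labels to all but one or two clique vertices. What remains of \<open>H\<close>
  is close to the star formed by the hub and the middle vertices, so three labels suffice there,
  and it is easy to see when labels 1 and 2 may repeat
  (\<open>is_ranking_if_low_labels_sparse\<close>). With \<open>n + 1\<close> labels this leaves enough room to make any
  chosen middle or clique vertex the only one with label 1. With \<open>n\<close> labels it ranks every
  graph obtained by deleting or contracting one edge \<open>xy\<close>: a single labelling with the same label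
  on \<open>x\<close> and \<open>y\<close>, whose only flaw is that repetition, serves both purposes
  (\<open>minor_rankings_if_constant_on_edge\<close>). Rankings pass to further minors with the same number
  of labels (\<open>is_ranking_minor_step\<close>), so all proper minors have tree-depth at most \<open>n\<close>.

  Lower bound. Suppose that \<open>n\<close> labels are available. The clique uses all of them but one, \<open>t\<close>.
  A middle vertex that does not get \<open>t\<close> shares its label with a clique vertex, and this label must be
  smaller than that of its own clique neighbour (\<open>mid_label_below\<close>). Hence the middle vertex of the
  lowest clique vertex \<open>p\<close> gets \<open>t\<close>, and that of the second lowest, \<open>q\<close>, gets \<open>t\<close> or the label of
  \<open>p\<close>. The hub shares its label with some clique vertex, and in each case a path with at most
  two spokes is violated (\<open>no_ranking_with_card_V_labels\<close>).

  The hub. If the hub alone had label 1 in a ranking with \<open>n + 1\<close> labels, the remaining vertices would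
  again have \<open>n\<close> labels, and no two middle vertices could agree. The middle vertices of the
  three lowest clique vertices \<open>p\<close>, \<open>q\<close>, \<open>r\<close> would then be forced to have \<open>t\<close>, the label of \<open>p\<close>
  and the label of \<open>q\<close>. The path from the middle of \<open>r\<close> through the hub and the middle of \<open>q\<close> to
  \<open>q\<close> joins two equal labels and meets only smaller ones in between (\<open>hub_not_only_one\<close>).
  The three clique vertices are where \<open>n \<ge> 4\<close> is used; for \<open>n = 3\<close> the graph is a 5-cycle,
  which is 1-unique.
\<close>

section \<open>Rankings through reachability below a label\<close>

text \<open>
  A ranking is a labelling in which no two vertices of equal label \<open>t\<close> are connected through labels
  at most \<open>t\<close>. Expressed as reachability this is easier to transport along contractions than
  paths, because no vertex has to be kept from occurring twice.
\<close>

definition low_step :: "'a graph \<Rightarrow> ('a \<Rightarrow> nat) \<Rightarrow> nat \<Rightarrow> 'a \<Rightarrow> 'a \<Rightarrow> bool" where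
  "low_step G f t x y \<longleftrightarrow> {x, y} \<in> edges G \<and> f x \<le> t \<and> f y \<le> t"

lemma edge_endpoints:
  assumes "simple_graph G" "{x, y} \<in> edges G"
  shows "x \<in> verts G" "y \<in> verts G" "x \<noteq> y"
  using assms by (auto simp: simple_graph_def)

lemma successively_imp_rtranclp: "p \<noteq> [] \<Longrightarrow> successively R p \<Longrightarrow> R\<^sup>*\<^sup>* (hd p) (last p)"
  by (induction R p rule: successively.induct) (auto intro: converse_rtranclp_into_rtranclp)

lemma low_reach_imp_path:
  assumes G: "simple_graph G" and "(low_step G f t)\<^sup>*\<^sup>* a b" and "a \<in> verts G" "f a \<le> t"
  shows "\<exists>p. is_path G p \<and> hd p = a \<and> last p = b \<and> (\<forall>z\<in>set p. f z \<le> t)"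
  using assms(2)
proof (induction rule: rtranclp_induct)
  case base
  show ?case using assms(3,4) by (intro exI[of _ "[a]"]) (simp add: is_path_def)
next
  case (step y z)
  then obtain p where p: "is_path G p" "hd p = a" "last p = y" "\<forall>z\<in>set p. f z \<le> t"
    by blast
  have yz: "{y, z} \<in> edges G" "f z \<le> t" "z \<in> verts G"
    using step.hyps(2) edge_endpoints[OF G] by (auto simp: low_step_def)
  show ?case
  proof (cases "z \<in> set p")
    case True
    then obtain xs ys where xs: "p = xs @ z # ys" by (meson split_list)
    then have "is_path G (xs @ [z])" "hd (xs @ [z]) = a"
      using p(1,2) by (auto simp: is_path_def successively_append_iff hd_append)
    then show ?thesis using p(4) xs by (intro exI[of _ "xs @ [z]"]) auto
  next
    case False
    then have "is_path G (p @ [z])" "hd (p @ [z]) = a"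
      using p yz by (auto simp: is_path_def successively_append_iff hd_append)
    then show ?thesis using p(4) yz by (intro exI[of _ "p @ [z]"]) auto
  qed
qed

lemma is_ranking_iff:
  assumes G: "simple_graph G"
  shows "is_ranking G k f \<longleftrightarrow>
    (\<forall>x\<in>verts G. f x \<in> {1..k}) \<and>
    (\<forall>a\<in>verts G. \<forall>b\<in>verts G. a \<noteq> b \<and> f a = f b \<longrightarrow> \<not> (low_step G f (f a))\<^sup>*\<^sup>* a b)"
    (is "?L \<longleftrightarrow> ?R")
proof
  assume L: ?L
  show ?R
  proof (intro conjI ballI impI notI)
    fix a b assume ab: "a \<in> verts G" "b \<in> verts G" "a \<noteq> b \<and> f a = f b"
      and "(low_step G f (f a))\<^sup>*\<^sup>* a b"
    from low_reach_imp_path[OF G this(4) ab(1)] obtain p where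
      p: "is_path G p" "hd p = a" "last p = b" "\<forall>z\<in>set p. f z \<le> f a" by auto
    then have "\<exists>z\<in>set p. f z > f (hd p)" using L ab unfolding is_ranking_def by metis
    then show False using p by auto
  qed (use L in \<open>auto simp: is_ranking_def\<close>)
next
  assume R: ?R
  show ?L
    unfolding is_ranking_def
  proof (intro conjI allI impI)
    fix p assume p: "is_path G p \<and> hd p \<noteq> last p \<and> f (hd p) = f (last p)"
    show "\<exists>z\<in>set p. f z > f (hd p)"
    proof (rule ccontr)
      assume "\<not> ?thesis"
      then have "\<forall>z\<in>set p. f z \<le> f (hd p)" by auto
      then have "successively (low_step G f (f (hd p))) p"
        using p unfolding is_path_def low_step_def
        by (auto elim!: successively_mono)
      then have "(low_step G f (f (hd p)))\<^sup>*\<^sup>* (hd p) (last p)"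
        using p by (intro successively_imp_rtranclp) (auto simp: is_path_def)
      moreover have "hd p \<in> verts G" "last p \<in> verts G"
        using p by (auto simp: is_path_def subset_iff)
      ultimately show False using R p by blast
    qed
  qed (use R in auto)
qed


section \<open>Rankings of minors\<close>

lemma is_ranking_mono_labels: "is_ranking G k f \<Longrightarrow> k \<le> l \<Longrightarrow> is_ranking G l f"
  by (fastforce simp: is_ranking_def)

lemma is_ranking_subgraph:
  assumes "is_ranking G k f" "verts M \<subseteq> verts G" "edges M \<subseteq> edges G"
  shows "is_ranking M k f"
proof -
  have "is_path G p" if "is_path M p" for p
    using that assms(2,3) unfolding is_path_def by (auto elim!: successively_mono)
  then show ?thesis using assms(1,2) unfolding is_ranking_def by blast
qed

lemma contract_edge_lift:
  assumes G: "simple_graph G" and "{a, b} \<in> edges (contract_edge G x y)"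
  obtains a' b' where "{a', b'} \<in> edges G" "a \<noteq> b"
    "a = (if a' = y then x else a')" "b = (if b' = y then x else b')"
proof -
  let ?q = "\<lambda>z. if z = y then x else z"
  have "{a, b} \<in> (\<lambda>e. ?q ` e) ` edges G" "card {a, b} = 2"
    using assms(2) unfolding contract_edge_def by simp_all
  then obtain e where e: "e \<in> edges G" "{a, b} = ?q ` e" by (elim imageE)
  have ne: "a \<noteq> b" using \<open>card {a, b} = 2\<close> by auto
  have "a \<in> ?q ` e" "b \<in> ?q ` e" unfolding e(2)[symmetric] by simp_all
  then obtain a' b' where ab: "a' \<in> e" "b' \<in> e" "a = ?q a'" "b = ?q b'"
    by (elim imageE)
  have "card e = 2" using G e(1) by (auto simp: simple_graph_def)
  then have "e = {a', b'}" using ab ne by (auto simp: card_2_iff)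
  then show ?thesis using that e(1) ab ne by blast
qed

text \<open>
  A merged vertex with the larger of the two labels can be crossed below level \<open>t\<close> only if both old
  vertices can, so every low walk of the contracted graph lifts to a low walk of the old graph.
\<close>

lemma is_ranking_contract_edge:
  assumes G: "simple_graph G" and xy: "{x, y} \<in> edges G" and f: "is_ranking G k f"
  shows "is_ranking (contract_edge G x y) k (f(x := max (f x) (f y)))"
proof -
  let ?M = "contract_edge G x y" and ?g = "f(x := max (f x) (f y))"
  have M: "simple_graph ?M"
    using G xy by (auto intro: simple_graph_minor_step minor_step.intros)
  have V: "verts ?M = verts G - {y}" by (simp add: contract_edge_def)
  have xyV: "x \<in> verts G" "y \<in> verts G" "x \<noteq> y" using edge_endpoints[OF G xy] by auto
  have R: "\<And>a b. \<lbrakk>a \<in> verts G; b \<in> verts G; a \<noteq> b; f a = f b\<rbrakk>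
      \<Longrightarrow> \<not> (low_step G f (f a))\<^sup>*\<^sup>* a b" and lab: "\<forall>x\<in>verts G. f x \<in> {1..k}"
    using f is_ranking_iff[OF G] by blast+
  have jump: "(low_step G f t)\<^sup>*\<^sup>* x y" "(low_step G f t)\<^sup>*\<^sup>* y x" if "?g x \<le> t" for t
    using that xy by (auto simp: low_step_def insert_commute)
  have lift: "(low_step G f t)\<^sup>*\<^sup>* c d" if "low_step ?M ?g t c d" for t c d
  proof -
    have cd: "{c, d} \<in> edges ?M" and le: "?g c \<le> t" "?g d \<le> t"
      using that by (auto simp: low_step_def)
    obtain c' d' where e: "{c', d'} \<in> edges G"
      "c = (if c' = y then x else c')" "d = (if d' = y then x else d')"
      using contract_edge_lift[OF G cd] by metis
    have "(low_step G f t)\<^sup>*\<^sup>* c c'" "(low_step G f t)\<^sup>*\<^sup>* d' d"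
      using e(2,3) le jump by (auto split: if_splits)
    moreover have "low_step G f t c' d'"
      using e le by (auto simp: low_step_def split: if_splits)
    ultimately show ?thesis by (meson rtranclp.rtrancl_into_rtrancl rtranclp_trans)
  qed
  have lifts: "(low_step G f t)\<^sup>*\<^sup>* c d" if "(low_step ?M ?g t)\<^sup>*\<^sup>* c d" for t c d
    using that by (induction rule: rtranclp_induct) (auto dest: lift)
  show ?thesis
    unfolding is_ranking_iff[OF M]
  proof (intro conjI ballI impI notI)
    show "?g z \<in> {1..k}" if "z \<in> verts ?M" for z
      using that lab xyV V by (auto simp: max_def)
  next
    fix a b
    assume ab: "a \<in> verts ?M" "b \<in> verts ?M" "a \<noteq> b \<and> ?g a = ?g b"
      and "(low_step ?M ?g (?g a))\<^sup>*\<^sup>* a b"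
    then have reach: "(low_step G f (?g a))\<^sup>*\<^sup>* a b" by (intro lifts)
    \<comment> \<open>A vertex whose label did not change represents each end of the path; for the merged
      vertex it is whichever of \<open>x\<close>, \<open>y\<close> had the larger label.\<close>
    have rep: "\<exists>c'. c' \<in> verts G \<and> f c' = ?g a \<and> (c' = c \<or> c = x \<and> c' = y) \<and>
        (low_step G f (?g a))\<^sup>*\<^sup>* c c' \<and> (low_step G f (?g a))\<^sup>*\<^sup>* c' c"
      if "c \<in> verts ?M" "?g c = ?g a" for c
    proof (cases "c = x \<and> f x < f y")
      case True
      then show ?thesis using that jump[of "?g a"] xyV by (intro exI[of _ y]) auto
    next
      case False
      then show ?thesis using that V by (intro exI[of _ c]) (auto split: if_splits)
    qed
    obtain a' where a': "a' \<in> verts G" "f a' = ?g a" "a' = a \<or> a = x \<and> a' = y"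
      "(low_step G f (?g a))\<^sup>*\<^sup>* a' a" using rep[of a] ab by blast
    obtain b' where b': "b' \<in> verts G" "f b' = ?g a" "b' = b \<or> b = x \<and> b' = y"
      "(low_step G f (?g a))\<^sup>*\<^sup>* b b'" using rep[of b] ab by metis
    have "(low_step G f (?g a))\<^sup>*\<^sup>* a' b'" using a' reach b' by (meson rtranclp_trans)
    moreover have "a' \<noteq> b'" using a'(3) b'(3) ab V by auto
    ultimately show False using R[OF a'(1) b'(1)] a'(2) b'(2) by simp
  qed
qed

lemma is_ranking_minor_step:
  assumes "minor_step G M" "simple_graph G" "is_ranking G k f"
  shows "\<exists>g. is_ranking M k g"
  using assms
proof (induction rule: minor_step.induct)
  case (vertex_deletion x G)
  have "is_ranking (delete_vertex G x) k f"
    by (rule is_ranking_subgraph[OF vertex_deletion(3)]) (auto simp: delete_vertex_def)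
  then show ?case by (rule exI[of _ f])
next
  case (edge_deletion e G)
  have "is_ranking (delete_edge G e) k f"
    by (rule is_ranking_subgraph[OF edge_deletion(3)]) (auto simp: delete_edge_def)
  then show ?case by (rule exI[of _ f])
next
  case (edge_contraction x y G)
  have "is_ranking (contract_edge G x y) k (f(x := max (f x) (f y)))"
    by (rule is_ranking_contract_edge[OF edge_contraction(2,1,3)])
  then show ?case by (rule exI[of _ "f(x := max (f x) (f y))"])
qed

lemma proper_minor_rankingI:
  assumes "proper_minor M G" "simple_graph G"
    and first: "\<And>N. minor_step G N \<Longrightarrow> \<exists>f. is_ranking N k f"
  shows "\<exists>f. is_ranking M k f"
proof -
  have "simple_graph M \<and> (\<exists>f. is_ranking M k f)"
    using assms(1) unfolding proper_minor_def
  proof (induction rule: tranclp_induct)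
    case (base N)
    then show ?case using first simple_graph_minor_step assms(2) by blast
  next
    case (step N N')
    then show ?case using is_ranking_minor_step simple_graph_minor_step by blast
  qed
  then show ?thesis by blast
qed


section \<open>Rankings in which only the labels 1 and 2 repeat\<close>

text \<open>
  Labels from 3 on do not repeat. As 1 and 2 are used on independent sets and no vertex with label 1
  has two neighbours with label 2, each component of the vertices with label at most 2 is a star with at
  most one vertex of label 2.
\<close>

lemma is_ranking_if_low_labels_sparse:
  assumes G: "simple_graph G"
    and lab: "\<And>x. x \<in> verts G \<Longrightarrow> f x \<in> {1..k}"
    and high: "\<And>a b. \<lbrakk>a \<in> verts G; b \<in> verts G; f a = f b; 3 \<le> f a\<rbrakk> \<Longrightarrow> a = b"
    and proper: "\<And>a b. {a, b} \<in> edges G \<Longrightarrow> f a \<noteq> f b"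
    and cherry: "\<And>a b c. \<lbrakk>{a, c} \<in> edges G; {c, b} \<in> edges G; f c = 1; f a = 2; f b = 2\<rbrakk> \<Longrightarrow> a = b"
  shows "is_ranking G k f"
  unfolding is_ranking_iff[OF G]
proof (intro conjI ballI impI notI)
  fix a b assume ab: "a \<in> verts G" "b \<in> verts G" "a \<noteq> b \<and> f a = f b"
    and reach: "(low_step G f (f a))\<^sup>*\<^sup>* a b"
  have pos: "f y = 1 \<or> f y = 2" if "{x, y} \<in> edges G" "f y \<le> 2" for x y
    using lab[OF edge_endpoints(2)[OF G that(1)]] that(2) by auto
  have "1 \<le> f a" using lab[OF ab(1)] by simp
  then consider "f a = 1" | "f a = 2" | "3 \<le> f a" by linarith
  then show False
  proof cases
    case 1
    from reach have "b = a"
    proof (induction rule: rtranclp_induct)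
      case (step y z)
      then have yz: "{y, z} \<in> edges G" "f y = 1" "f z \<le> 1"
        using 1 by (auto simp: low_step_def)
      then have "f z = 1" using lab[OF edge_endpoints(2)[OF G yz(1)]] by simp
      then show ?case using proper[OF yz(1)] yz by simp
    qed simp
    then show False using ab by simp
  next
    case 2
    \<comment> \<open>Below level 2 the component of \<open>a\<close> is \<open>a\<close> with its neighbours of label 1.\<close>
    from reach have "b = a \<or> {a, b} \<in> edges G \<and> f b = 1"
    proof (induction rule: rtranclp_induct)
      case (step y z)
      have z: "{y, z} \<in> edges G" "f z = 1 \<or> f z = 2"
        using step.hyps(2) 2 pos[of y z] by (auto simp: low_step_def)
      from step.IH show ?case
      proof
        assume "y = a"
        then show ?thesis using z proper[OF z(1)] 2 by auto
      next
        assume "{a, y} \<in> edges G \<and> f y = 1"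
        then show ?thesis using z proper[OF z(1)] cherry[of a y z] 2 by auto
      qed
    qed simp
    then show False using ab 2 by auto
  next
    case 3
    then show False using high[of a b] ab by simp
  qed
qed (use lab in auto)

text \<open>
  For graphs that a single edge keeps from being of this simple form: the only repetition of a label
  above 1, and the only edge inside label 1, may occur on the pair \<open>x\<close>, \<open>y\<close>. Contracting the
  edge turns the pair into one vertex; deleting it makes the repetition harmless, provided that \<open>x\<close> and
  \<open>y\<close> do not stay connected through a vertex with label 1.
\<close>

context
  fixes G :: "'a graph" and x y :: 'a and f :: "'a \<Rightarrow> nat" and k :: nat
  assumes G: "simple_graph G" and xy: "{x, y} \<in> edges G" and eq: "f x = f y"
    and lab: "\<And>z. z \<in> verts G \<Longrightarrow> f z \<in> {1..k}"
    and unique: "\<And>a b. \<lbrakk>a \<in> verts G; b \<in> verts G; f a = f b; 2 \<le> f a; a \<noteq> b\<rbrakk> \<Longrightarrow> {a, b} = {x, y}"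
    and indep: "\<And>a b. \<lbrakk>{a, b} \<in> edges G; f a = 1; f b = 1\<rbrakk> \<Longrightarrow> {a, b} = {x, y}"
begin

lemma is_ranking_delete_edge_if_constant:
  assumes low: "f x \<le> 2"
    and no_triangle: "\<And>c. \<lbrakk>{x, c} \<in> edges G; {c, y} \<in> edges G; f c = 1; f x = 2\<rbrakk> \<Longrightarrow> False"
  shows "is_ranking (delete_edge G {x, y}) k f"
proof -
  let ?D = "delete_edge G {x, y}"
  have D: "simple_graph ?D"
    using G xy by (auto intro: simple_graph_minor_step minor_step.intros)
  have pos: "f z = 1 \<or> 2 \<le> f z" if "z \<in> verts G" for z using lab[OF that] by auto
  show ?thesis
  proof (rule is_ranking_if_low_labels_sparse[OF D])
    fix a b assume e: "{a, b} \<in> edges ?D"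
    then have "{a, b} \<in> edges G" "{a, b} \<noteq> {x, y}" by (auto simp: delete_edge_def)
    then show "f a \<noteq> f b"
      using edge_endpoints[OF G, of a b] pos[of a] unique[of a b] indep[of a b] by metis
  next
    fix a b assume ab: "a \<in> verts ?D" "b \<in> verts ?D" "f a = f b" "3 \<le> f a"
    show "a = b"
    proof (rule ccontr)
      assume "a \<noteq> b"
      then have "{a, b} = {x, y}" using ab by (intro unique) (simp_all add: delete_edge_def)
      then show False using ab low eq by (auto simp: doubleton_eq_iff)
    qed
  next
    fix a b c
    assume e: "{a, c} \<in> edges ?D" "{c, b} \<in> edges ?D" and l: "f c = 1" "f a = 2" "f b = 2"
    have e': "{a, c} \<in> edges G" "{c, b} \<in> edges G" using e by (auto simp: delete_edge_def)
    show "a = b"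
    proof (rule ccontr)
      assume "a \<noteq> b"
      then have "{a, b} = {x, y}"
        using l edge_endpoints[OF G e'(1)] edge_endpoints[OF G e'(2)] by (intro unique) simp_all
      then show False using no_triangle[of c] e' l by (auto simp: doubleton_eq_iff insert_commute)
    qed
  qed (use lab in \<open>auto simp: delete_edge_def\<close>)
qed

lemma is_ranking_contract_edge_if_constant: "is_ranking (contract_edge G x y) k f"
proof -
  let ?C = "contract_edge G x y"
  have C: "simple_graph ?C"
    using G xy by (auto intro: simple_graph_minor_step minor_step.intros)
  have pos: "f z = 1 \<or> 2 \<le> f z" if "z \<in> verts G" for z using lab[OF that] by auto
  have inj: "a = b" if "a \<in> verts ?C" "b \<in> verts ?C" "f a = f b" "2 \<le> f a" for a b
  proof (rule ccontr)
    assume "a \<noteq> b"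
    then have "{a, b} = {x, y}" using that by (intro unique) (simp_all add: contract_edge_def)
    then show False using that by (auto simp: contract_edge_def)
  qed
  show ?thesis
  proof (rule is_ranking_if_low_labels_sparse[OF C])
    fix a b assume e: "{a, b} \<in> edges ?C"
    obtain a' b' where ab: "{a', b'} \<in> edges G" "a \<noteq> b"
      "a = (if a' = y then x else a')" "b = (if b' = y then x else b')"
      using contract_edge_lift[OF G e] by metis
    then have "f a' = f a" "f b' = f b" "{a', b'} \<noteq> {x, y}"
      using eq by (auto simp: doubleton_eq_iff)
    then have no: "\<not> (f a = 1 \<and> f b = 1)" using ab(1) indep by metis
    show "f a \<noteq> f b"
    proof
      assume "f a = f b"
      moreover have "a \<in> verts G" using edge_endpoints[OF C e] by (simp add: contract_edge_def)
      ultimately show False using no ab(2) inj[of a b] edge_endpoints[OF C e] pos[of a] by auto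
    qed
  next
    fix a b c
    assume e: "{a, c} \<in> edges ?C" "{c, b} \<in> edges ?C" and l: "f c = 1" "f a = 2" "f b = 2"
    then show "a = b"
      using inj[of a b] edge_endpoints[OF C e(1)] edge_endpoints[OF C e(2)] by simp
  next
    show "f z \<in> {1..k}" if "z \<in> verts ?C" for z
      using that lab by (simp add: contract_edge_def)
  next
    show "a = b" if "a \<in> verts ?C" "b \<in> verts ?C" "f a = f b" "3 \<le> f a" for a b
      using that by (intro inj) simp_all
  qed
qed

end

lemma minor_rankings_if_constant_on_edge:
  assumes G: "simple_graph G" and xy: "{x, y} \<in> edges G" and eq: "f x = f y"
    and lab: "\<And>z. z \<in> verts G \<Longrightarrow> f z \<in> {1..k}" and low: "f x \<le> 2"
    and unique: "\<And>a b. \<lbrakk>a \<in> verts G; b \<in> verts G; f a = f b; 2 \<le> f a; a \<noteq> b\<rbrakk> \<Longrightarrow> {a, b} = {x, y}"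
    and indep: "\<And>a b. \<lbrakk>{a, b} \<in> edges G; f a = 1; f b = 1\<rbrakk> \<Longrightarrow> {a, b} = {x, y}"
    and no_triangle: "\<And>c. \<lbrakk>{x, c} \<in> edges G; {c, y} \<in> edges G; f c = 1; f x = 2\<rbrakk> \<Longrightarrow> False"
  shows "is_ranking (delete_edge G {x, y}) k f \<and>
    is_ranking (contract_edge G x y) k f \<and> is_ranking (contract_edge G y x) k f"
proof (intro conjI)
  show "is_ranking (delete_edge G {x, y}) k f"
    by (rule is_ranking_delete_edge_if_constant[of G x y f, OF G xy eq lab unique indep low no_triangle])
  show "is_ranking (contract_edge G x y) k f"
    by (rule is_ranking_contract_edge_if_constant[of G x y f, OF G xy eq lab unique indep])
  have yx: "{x, y} = {y, x}" by (rule insert_commute)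
  show "is_ranking (contract_edge G y x) k f"
    by (rule is_ranking_contract_edge_if_constant[of G y x f, OF G xy[unfolded yx] eq[symmetric] lab
          unique[unfolded yx] indep[unfolded yx]])
qed


section \<open>The complete graph with the edges at one vertex subdivided\<close>

lemma obtain_distinct_labels:
  fixes s :: nat
  assumes "finite A"
  obtains h where "\<And>x y. x \<in> A \<Longrightarrow> y \<in> A \<Longrightarrow> h x = h y \<longleftrightarrow> x = y"
    "\<And>x. x \<in> A \<Longrightarrow> s \<le> h x" "\<And>x. x \<in> A \<Longrightarrow> h x < s + card A"
proof -
  obtain h where h: "bij_betw h A {0..<card A}" using ex_bij_betw_finite_nat[OF assms] by blast
  have "h x < card A" if "x \<in> A" for x using h that by (auto simp: bij_betw_def)
  then show ?thesis
    using that[of "\<lambda>x. s + h x"] h by (auto simp: bij_betw_def inj_on_eq_iff)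
qed

context
  fixes V :: "'a set" and v :: 'a
  assumes fin: "finite V" and v: "v \<in> V"
begin

text \<open>The middle of the spoke at \<open>c\<close> subdivides the edge \<open>{v, c}\<close> and therefore carries that name.\<close>

abbreviation H :: "('a + 'a set) graph" where "H \<equiv> subdivide_at (complete_graph V) v"
abbreviation C :: "'a set" where "C \<equiv> V - {v}"
abbreviation hub :: "'a + 'a set" where "hub \<equiv> Inl v"
abbreviation mid :: "'a \<Rightarrow> 'a + 'a set" where "mid c \<equiv> Inr {v, c}"

lemma simple_H: "simple_graph H"
  by (simp add: fin simple_graph_complete simple_graph_subdivide_at)

lemma spokes_eq: "{e \<in> edges (complete_graph V). v \<in> e} = (\<lambda>c. {v, c}) ` C"
  using v by (auto simp: complete_graph_def card_2_iff insert_commute)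

lemma verts_H: "verts H = insert hub (Inl ` C \<union> mid ` C)"
  using v unfolding subdivide_at_def spokes_eq
  by (auto simp: subdivide_edges_def complete_graph_def)

lemma edges_H:
  "edges H = (\<lambda>e. Inl ` e) ` {e. e \<subseteq> C \<and> card e = 2} \<union>
     {{Inl x, mid c} | x c. c \<in> C \<and> (x = v \<or> x = c)}"
proof -
  have "edges (complete_graph V) - (\<lambda>c. {v, c}) ` C = {e. e \<subseteq> C \<and> card e = 2}"
    unfolding spokes_eq[symmetric] by (auto simp: complete_graph_def)
  then show ?thesis
    unfolding subdivide_at_def spokes_eq by (auto simp: subdivide_edges_def)
qed

lemma edge_H_Inl_Inl: "{Inl x, Inl y} \<in> edges H \<longleftrightarrow> x \<in> C \<and> y \<in> C \<and> x \<noteq> y"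
proof -
  have "({Inl x, Inl y} :: ('a + 'a set) set) = Inl ` {x, y}" by simp
  then have "{Inl x, Inl y} \<in> edges H \<longleftrightarrow> {x, y} \<in> {e. e \<subseteq> C \<and> card e = 2}"
    unfolding edges_H
    by (auto simp: image_iff inj_image_eq_iff doubleton_eq_iff simp del: image_insert)
  then show ?thesis by (auto simp: card_insert_if)
qed

lemma edge_H_Inr_Inr: "{Inr d, Inr e} \<notin> edges H"
  unfolding edges_H by (auto simp: doubleton_eq_iff)

lemma edge_H_Inl_Inr:
  "{Inl x, Inr e} \<in> edges H \<longleftrightarrow> (\<exists>c\<in>C. e = {v, c} \<and> (x = v \<or> x = c))"
  unfolding edges_H by (auto simp: doubleton_eq_iff)

lemma edge_H_Inr_Inl:
  "{Inr e, Inl x} \<in> edges H \<longleftrightarrow> (\<exists>c\<in>C. e = {v, c} \<and> (x = v \<or> x = c))"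
  using edge_H_Inl_Inr by (simp add: insert_commute)

lemmas edge_H = edge_H_Inl_Inl edge_H_Inr_Inr edge_H_Inl_Inr edge_H_Inr_Inl

lemma neighbour_mid: "c \<in> C \<Longrightarrow> {z, mid c} \<in> edges H \<longleftrightarrow> z = hub \<or> z = Inl c"
  by (cases z) (auto simp: edge_H doubleton_eq_iff)

lemma neighbour_clique:
  "c \<in> C \<Longrightarrow> {z, Inl c} \<in> edges H \<longleftrightarrow> z = mid c \<or> (\<exists>d\<in>C - {c}. z = Inl d)"
  by (cases z) (auto simp: edge_H)

lemma mid_eq_iff: "c \<in> C \<Longrightarrow> mid c = mid d \<longleftrightarrow> c = d"
  by (auto simp: doubleton_eq_iff)

lemma verts_H_cases:
  assumes "z \<in> verts H"
  obtains "z = hub" | c where "c \<in> C" "z = Inl c" | c where "c \<in> C" "z = mid c"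
  using assms unfolding verts_H by blast

lemma edges_H_cases:
  assumes "{x, y} \<in> edges H"
  obtains c where "c \<in> C" "{x, y} = {hub, mid c}"
    | c where "c \<in> C" "{x, y} = {mid c, Inl c}"
    | c d where "c \<in> C" "d \<in> C" "c \<noteq> d" "{x, y} = {Inl c, Inl d}"
proof (cases x; cases y)
  fix p q assume "x = Inl p" "y = Inl q"
  then show ?thesis using assms that(3)[of p q] by (simp add: edge_H)
next
  fix p q assume "x = Inl p" "y = Inr q"
  then show ?thesis using assms that(1,2) by (auto simp: edge_H insert_commute)
next
  fix p q assume "x = Inr p" "y = Inl q"
  then show ?thesis using assms that(1,2) by (auto simp: edge_H insert_commute)
next
  fix p q assume "x = Inr p" "y = Inr q"
  then show ?thesis using assms by (simp add: edge_H)
qed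

lemma card_C_minus: "i \<in> C \<Longrightarrow> card (C - {i}) + 2 = card V"
  using fin v card_Suc_Diff1[of C i] card_Suc_Diff1[of V v] by simp

lemma card_C_minus2:
  assumes "i \<in> C \<and> j \<in> C \<and> i \<noteq> j"
  shows "card (C - {i, j}) + 3 = card V"
proof -
  have "C - {i, j} = C - {i} - {j}" by blast
  moreover have "Suc (card (C - {i} - {j})) = card (C - {i})"
    using assms fin by (intro card_Suc_Diff1) auto
  ultimately show ?thesis using card_C_minus[of i] assms by simp
qed


section \<open>Rankings of the subdivided graph and of its minors\<close>

text \<open>
  Middle vertices are addressed through their spoke: \<open>THE\<close> recovers \<open>c\<close> from the name \<open>{v, c}\<close>,
  so that all labellings can be given by functions on the vertices of the complete graph.
\<close>

definition labelling :: "nat \<Rightarrow> ('a \<Rightarrow> nat) \<Rightarrow> ('a \<Rightarrow> nat) \<Rightarrow> 'a + 'a set \<Rightarrow> nat" where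
  "labelling w a m z =
     (case z of Inl x \<Rightarrow> if x = v then w else a x | Inr e \<Rightarrow> m (THE c. e = {v, c}))"

lemma labelling_Inl: "labelling w a m (Inl x) = (if x = v then w else a x)"
  by (simp add: labelling_def)

lemma labelling_mid: "labelling w a m (mid c) = m c"
proof -
  have "(THE d. {v, c} = {v, d}) = c"
    by (intro the_equality) (auto simp: doubleton_eq_iff)
  then show ?thesis by (simp add: labelling_def)
qed

lemmas labelling_simps = labelling_Inl labelling_mid

text \<open>
  With label 1 confined to one middle vertex, its two neighbours have to differ: the clique
  neighbour gets 2, like all other middle vertices, and the hub gets 3, which separates them.
\<close>

lemma only_mid_labelled_one:
  assumes i: "i \<in> C" and card: "card V = n"
  shows "\<exists>f. is_ranking H (n + 1) f \<and> {x \<in> verts H. f x = 1} = {mid i}"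
proof -
  have n: "card (C - {i}) + 2 = n" using card_C_minus[OF i] card by simp
  obtain h where inj: "\<And>c d. c \<in> C - {i} \<Longrightarrow> d \<in> C - {i} \<Longrightarrow> h c = h d \<longleftrightarrow> c = d"
    and ge: "\<And>c. c \<in> C - {i} \<Longrightarrow> 4 \<le> h c"
    and less: "\<And>c. c \<in> C - {i} \<Longrightarrow> h c < 4 + card (C - {i})"
    using obtain_distinct_labels[of "C - {i}" 4] fin by auto
  have ne: "h c \<noteq> 1 \<and> h c \<noteq> Suc 0 \<and> Suc 0 \<noteq> h c \<and> h c \<noteq> 2 \<and> h c \<noteq> 3" if "c \<in> C - {i}" for c
    using ge[OF that] by auto
  let ?f = "labelling 3 (h(i := 2)) ((\<lambda>_. 2)(i := 1))"
  have one: "{x \<in> verts H. ?f x = 1} = {mid i}"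
    using i by (auto simp: verts_H labelling_simps ne split: if_splits)
  have "is_ranking H (n + 1) ?f"
  proof (rule is_ranking_if_low_labels_sparse[OF simple_H])
    show "?f z \<in> {1..n + 1}" if "z \<in> verts H" for z
      using that
    proof (cases z rule: verts_H_cases)
      case (2 c)
      then show ?thesis using ge[of c] less[of c] n by (auto simp: labelling_simps)
    qed (use n i in \<open>auto simp: labelling_simps\<close>)
  next
    fix a b assume ab: "a \<in> verts H" "b \<in> verts H" "?f a = ?f b" "3 \<le> ?f a"
    show "a = b"
      by (rule verts_H_cases[OF ab(1)]; rule verts_H_cases[OF ab(2)])
        (use i ab(3-) in \<open>auto simp: labelling_simps inj ne split: if_splits\<close>)
  next
    fix a b assume "{a, b} \<in> edges H"
    then show "?f a \<noteq> ?f b"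
      using i by (cases a; cases b) (auto simp: edge_H labelling_simps inj ne split: if_splits)
  next
    fix a b c
    assume e: "{a, c} \<in> edges H" "{c, b} \<in> edges H" and l: "?f c = 1" "?f a = 2" "?f b = 2"
    have "c = mid i" using one l(1) edge_endpoints(2)[OF simple_H e(1)] by blast
    then have "{a, mid i} \<in> edges H" "{b, mid i} \<in> edges H" using e by (simp_all add: insert_commute)
    then show "a = b"
      unfolding neighbour_mid[OF i] using l(2,3) i by (auto simp: labelling_simps ne split: if_splits)
  qed
  with one show ?thesis by blast
qed

text \<open>
  Here all middle vertices get 2 and the hub, with 3, separates them. A clique vertex with label 1 sees
  only one of them, and all its other neighbours have labels at least 4.
\<close>

lemma only_clique_vertex_labelled_one:
  assumes i: "i \<in> C" and card: "card V = n"
  shows "\<exists>f. is_ranking H (n + 1) f \<and> {x \<in> verts H. f x = 1} = {Inl i}"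
proof -
  have n: "card (C - {i}) + 2 = n" using card_C_minus[OF i] card by simp
  obtain h where inj: "\<And>c d. c \<in> C - {i} \<Longrightarrow> d \<in> C - {i} \<Longrightarrow> h c = h d \<longleftrightarrow> c = d"
    and ge: "\<And>c. c \<in> C - {i} \<Longrightarrow> 4 \<le> h c"
    and less: "\<And>c. c \<in> C - {i} \<Longrightarrow> h c < 4 + card (C - {i})"
    using obtain_distinct_labels[of "C - {i}" 4] fin by auto
  have ne: "h c \<noteq> 1 \<and> h c \<noteq> Suc 0 \<and> Suc 0 \<noteq> h c \<and> h c \<noteq> 2 \<and> h c \<noteq> 3" if "c \<in> C - {i}" for c
    using ge[OF that] by auto
  let ?f = "labelling 3 (h(i := 1)) (\<lambda>_. 2)"
  have one: "{x \<in> verts H. ?f x = 1} = {Inl i}"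
    using i by (auto simp: verts_H labelling_simps ne split: if_splits)
  have "is_ranking H (n + 1) ?f"
  proof (rule is_ranking_if_low_labels_sparse[OF simple_H])
    show "?f z \<in> {1..n + 1}" if "z \<in> verts H" for z
      using that
    proof (cases z rule: verts_H_cases)
      case (2 c)
      then show ?thesis using ge[of c] less[of c] n by (auto simp: labelling_simps)
    qed (use n i in \<open>auto simp: labelling_simps\<close>)
  next
    fix a b assume ab: "a \<in> verts H" "b \<in> verts H" "?f a = ?f b" "3 \<le> ?f a"
    show "a = b"
      by (rule verts_H_cases[OF ab(1)]; rule verts_H_cases[OF ab(2)])
        (use i ab(3-) in \<open>auto simp: labelling_simps inj ne split: if_splits\<close>)
  next
    fix a b assume "{a, b} \<in> edges H"
    then show "?f a \<noteq> ?f b"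
      using i by (cases a; cases b) (auto simp: edge_H labelling_simps inj ne split: if_splits)
  next
    fix a b c
    assume e: "{a, c} \<in> edges H" "{c, b} \<in> edges H" and l: "?f c = 1" "?f a = 2" "?f b = 2"
    have "c = Inl i" using one l(1) edge_endpoints(2)[OF simple_H e(1)] by blast
    then have "{a, Inl i} \<in> edges H" "{b, Inl i} \<in> edges H" using e by (simp_all add: insert_commute)
    then show "a = b"
      unfolding neighbour_clique[OF i] using l(2,3) i by (auto simp: labelling_simps ne split: if_splits)
  qed
  with one show ?thesis by blast
qed

text \<open>
  Hub and middle \<open>i\<close> share 2; the clique vertex \<open>i\<close> can have 1 because its other neighbours have labels
  at least 3. The \<open>n - 2\<close> high labels fill \<open>{3..n}\<close>.
\<close>

lemma minor_rankings_hub_mid: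
  assumes i: "i \<in> C" and card: "card V = n" and n3: "n \<ge> 3"
  shows "\<exists>f. is_ranking (delete_edge H {hub, mid i}) n f \<and>
    is_ranking (contract_edge H (hub) (mid i)) n f \<and> is_ranking (contract_edge H (mid i) (hub)) n f"
proof -
  let ?A = "C - {i}"
  have n: "card ?A + 2 = n" using card_C_minus[OF i] card by simp
  obtain h where inj: "\<And>c d. c \<in> ?A \<Longrightarrow> d \<in> ?A \<Longrightarrow> h c = h d \<longleftrightarrow> c = d"
    and ge: "\<And>c. c \<in> ?A \<Longrightarrow> 3 \<le> h c"
    and less: "\<And>c. c \<in> ?A \<Longrightarrow> h c < 3 + card ?A"
    using obtain_distinct_labels[of ?A 3] fin by auto
  have ne: "h c \<noteq> 1 \<and> h c \<noteq> Suc 0 \<and> Suc 0 \<noteq> h c \<and> h c \<noteq> 2 \<and> h c \<noteq> 0" if "c \<in> ?A" for c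
    using ge[OF that] by auto
  let ?f = "labelling 2 (h(i := 1)) ((\<lambda>_. 1)(i := 2))"
  show ?thesis
  proof (rule exI[of _ ?f], rule minor_rankings_if_constant_on_edge[OF simple_H])
    show "{hub, mid i} \<in> edges H" "?f (hub) = ?f (mid i)" "?f (hub) \<le> 2"
      using i by (auto simp: edge_H labelling_simps)
  next
    show "?f z \<in> {1..n}" if "z \<in> verts H" for z
      using that
    proof (cases z rule: verts_H_cases)
      case (2 c)
      then show ?thesis using ge[of c] less[of c] n n3 by (auto simp: labelling_simps)
    qed (use n n3 i in \<open>auto simp: labelling_simps\<close>)
  next
    fix a b assume ab: "a \<in> verts H" "b \<in> verts H" "?f a = ?f b" "2 \<le> ?f a" "a \<noteq> b"
    show "{a, b} = {hub, mid i}"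
      by (rule verts_H_cases[OF ab(1)]; rule verts_H_cases[OF ab(2)])
        (use i ab(3-) in \<open>auto simp: labelling_simps inj ne split: if_splits\<close>)
  next
    fix a b assume "{a, b} \<in> edges H" "?f a = 1" "?f b = 1"
    then show "{a, b} = {hub, mid i}"
      using i by (cases a; cases b) (auto simp: edge_H labelling_simps inj ne split: if_splits)
  next
    fix c assume "{hub, c} \<in> edges H" "{c, mid i} \<in> edges H" "?f c = 1" "?f (hub) = 2"
    then show False
      using i by (cases c) (auto simp: edge_H labelling_simps ne split: if_splits)
  qed
qed

text \<open>
  Without the edge between middle \<open>i\<close> and clique vertex \<open>i\<close>, label 1 is used on an independent set
  that contains both; the hub is then the only vertex with label 2.
\<close>

lemma minor_rankings_mid_clique:
  assumes i: "i \<in> C" and card: "card V = n" and n3: "n \<ge> 3"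
  shows "\<exists>f. is_ranking (delete_edge H {mid i, Inl i}) n f \<and>
    is_ranking (contract_edge H (mid i) (Inl i)) n f \<and> is_ranking (contract_edge H (Inl i) (mid i)) n f"
proof -
  let ?A = "C - {i}"
  have n: "card ?A + 2 = n" using card_C_minus[OF i] card by simp
  obtain h where inj: "\<And>c d. c \<in> ?A \<Longrightarrow> d \<in> ?A \<Longrightarrow> h c = h d \<longleftrightarrow> c = d"
    and ge: "\<And>c. c \<in> ?A \<Longrightarrow> 3 \<le> h c"
    and less: "\<And>c. c \<in> ?A \<Longrightarrow> h c < 3 + card ?A"
    using obtain_distinct_labels[of ?A 3] fin by auto
  have ne: "h c \<noteq> 1 \<and> h c \<noteq> Suc 0 \<and> Suc 0 \<noteq> h c \<and> h c \<noteq> 2 \<and> h c \<noteq> 0" if "c \<in> ?A" for c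
    using ge[OF that] by auto
  let ?f = "labelling 2 (h(i := 1)) (\<lambda>_. 1)"
  show ?thesis
  proof (rule exI[of _ ?f], rule minor_rankings_if_constant_on_edge[OF simple_H])
    show "{mid i, Inl i} \<in> edges H" "?f (mid i) = ?f (Inl i)" "?f (mid i) \<le> 2"
      using i by (auto simp: edge_H labelling_simps)
  next
    show "?f z \<in> {1..n}" if "z \<in> verts H" for z
      using that
    proof (cases z rule: verts_H_cases)
      case (2 c)
      then show ?thesis using ge[of c] less[of c] n n3 by (auto simp: labelling_simps)
    qed (use n n3 i in \<open>auto simp: labelling_simps\<close>)
  next
    fix a b assume ab: "a \<in> verts H" "b \<in> verts H" "?f a = ?f b" "2 \<le> ?f a" "a \<noteq> b"
    show "{a, b} = {mid i, Inl i}"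
      by (rule verts_H_cases[OF ab(1)]; rule verts_H_cases[OF ab(2)])
        (use i ab(3-) in \<open>auto simp: labelling_simps inj ne split: if_splits\<close>)
  next
    fix a b assume "{a, b} \<in> edges H" "?f a = 1" "?f b = 1"
    then show "{a, b} = {mid i, Inl i}"
      using i by (cases a; cases b) (auto simp: edge_H labelling_simps inj ne split: if_splits)
  next
    fix c assume "{mid i, c} \<in> edges H" "{c, Inl i} \<in> edges H" "?f c = 1" "?f (mid i) = 2"
    then show False
      using i by (cases c) (auto simp: edge_H labelling_simps ne split: if_splits)
  qed
qed

text \<open>
  Both clique vertices get 2. Their middle vertices have label 1, so the hub must have 3; the other
  \<open>n - 3\<close> clique vertices fill \<open>{4..n}\<close>.
\<close>

lemma minor_rankings_clique_clique:
  assumes i: "i \<in> C \<and> j \<in> C \<and> i \<noteq> j" and card: "card V = n" and n3: "n \<ge> 3"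
  shows "\<exists>f. is_ranking (delete_edge H {Inl i, Inl j}) n f \<and>
    is_ranking (contract_edge H (Inl i) (Inl j)) n f \<and> is_ranking (contract_edge H (Inl j) (Inl i)) n f"
proof -
  let ?A = "C - {i, j}"
  have n: "card ?A + 3 = n" using card_C_minus2[OF i] card by simp
  obtain h where inj: "\<And>c d. c \<in> ?A \<Longrightarrow> d \<in> ?A \<Longrightarrow> h c = h d \<longleftrightarrow> c = d"
    and ge: "\<And>c. c \<in> ?A \<Longrightarrow> 4 \<le> h c"
    and less: "\<And>c. c \<in> ?A \<Longrightarrow> h c < 4 + card ?A"
    using obtain_distinct_labels[of ?A 4] fin by auto
  have ne: "h c \<noteq> 1 \<and> h c \<noteq> Suc 0 \<and> Suc 0 \<noteq> h c \<and> h c \<noteq> 2 \<and> h c \<noteq> 3" if "c \<in> ?A" for c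
    using ge[OF that] by auto
  let ?f = "labelling 3 (h(i := 2, j := 2)) (\<lambda>_. 1)"
  show ?thesis
  proof (rule exI[of _ ?f], rule minor_rankings_if_constant_on_edge[OF simple_H])
    show "{Inl i, Inl j} \<in> edges H" "?f (Inl i) = ?f (Inl j)" "?f (Inl i) \<le> 2"
      using i by (auto simp: edge_H labelling_simps)
  next
    show "?f z \<in> {1..n}" if "z \<in> verts H" for z
      using that
    proof (cases z rule: verts_H_cases)
      case (2 c)
      then show ?thesis using ge[of c] less[of c] n n3 by (auto simp: labelling_simps)
    qed (use n n3 i in \<open>auto simp: labelling_simps\<close>)
  next
    fix a b assume ab: "a \<in> verts H" "b \<in> verts H" "?f a = ?f b" "2 \<le> ?f a" "a \<noteq> b"
    show "{a, b} = {Inl i, Inl j}"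
      by (rule verts_H_cases[OF ab(1)]; rule verts_H_cases[OF ab(2)])
        (use i ab(3-) in \<open>auto simp: labelling_simps inj ne split: if_splits\<close>)
  next
    fix a b assume "{a, b} \<in> edges H" "?f a = 1" "?f b = 1"
    then show "{a, b} = {Inl i, Inl j}"
      using i by (cases a; cases b) (auto simp: edge_H labelling_simps inj ne split: if_splits)
  next
    fix c assume "{Inl i, c} \<in> edges H" "{c, Inl j} \<in> edges H" "?f c = 1" "?f (Inl i) = 2"
    then show False
      using i by (cases c) (auto simp: edge_H labelling_simps ne split: if_splits)
  qed
qed


section \<open>Obstructions to rankings with few labels\<close>

context
  fixes f :: "'a + 'a set \<Rightarrow> nat" and k :: nat
  assumes f: "is_ranking H k f"
begin

lemma ranking_path:
  "is_path H p \<Longrightarrow> hd p \<noteq> last p \<Longrightarrow> f (hd p) = f (last p) \<Longrightarrow> \<exists>z\<in>set p. f z > f (hd p)"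
  using f unfolding is_ranking_def by blast

text \<open>
  The ranking condition for paths inside one spoke, and below for paths that meet two spokes. These
  finitely many inequalities are all that the lower bounds need.
\<close>

lemma spoke_constraints:
  assumes "i \<in> C"
  shows "f (mid i) \<noteq> f (Inl i)" "f hub \<noteq> f (mid i)"
    and "f hub = f (Inl i) \<Longrightarrow> f (mid i) > f hub"
  using assms ranking_path[of "[mid i, Inl i]"] ranking_path[of "[hub, mid i]"]
    ranking_path[of "[hub, mid i, Inl i]"]
  by (auto simp: is_path_def verts_H edge_H)

lemma two_spokes_constraints:
  assumes "i \<in> C" "j \<in> C" "i \<noteq> j"
  shows "f (Inl i) \<noteq> f (Inl j)"
    and "f (mid i) = f (Inl j) \<Longrightarrow> f (Inl i) > f (Inl j)"
    and "f hub = f (Inl j) \<Longrightarrow> f (mid i) > f hub \<or> f (Inl i) > f hub"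
    and "f (mid i) = f (mid j) \<Longrightarrow> f hub > f (mid i)"
    and "f (mid j) = f (Inl i) \<Longrightarrow> f hub > f (Inl i) \<or> f (mid i) > f (Inl i)"
  using assms ranking_path[of "[Inl i, Inl j]"] ranking_path[of "[mid i, Inl i, Inl j]"]
    ranking_path[of "[hub, mid i, Inl i, Inl j]"] ranking_path[of "[mid i, hub, mid j]"]
    ranking_path[of "[mid j, hub, mid i, Inl i]"]
  by (auto simp: is_path_def verts_H edge_H mid_eq_iff)

text \<open>
  The label of the middle of \<open>i\<close> also occurs at a clique vertex \<open>j\<close>, and the clique vertex \<open>i\<close> is the
  only interior vertex of the path between the two.
\<close>

lemma mid_label_below:
  assumes "L - (\<lambda>c. f (Inl c)) ` C = {t}" and i: "i \<in> C" "f (mid i) \<in> L" "f (mid i) \<noteq> t"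
  shows "\<exists>j\<in>C. f (mid i) = f (Inl j) \<and> f (Inl j) < f (Inl i)"
proof -
  obtain j where "j \<in> C" "f (mid i) = f (Inl j)" using assms by blast
  then show ?thesis
    using spoke_constraints(1)[OF i(1)] two_spokes_constraints(2)[OF i(1)] by metis
qed

lemma obtain_missing_label:
  assumes "card V = n" "card L = n" "finite L" "\<And>c. c \<in> C \<Longrightarrow> f (Inl c) \<in> L"
  obtains t where "L - (\<lambda>c. f (Inl c)) ` C = {t}"
proof -
  have "inj_on (\<lambda>c. f (Inl c)) C"
    using two_spokes_constraints(1) by (auto simp: inj_on_def)
  then have "card ((\<lambda>c. f (Inl c)) ` C) = card C" by (rule card_image)
  moreover have "card C + 1 = n" using assms(1) fin v by (metis card_Suc_Diff1 Suc_eq_plus1)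
  ultimately have "card (L - (\<lambda>c. f (Inl c)) ` C) = 1"
    using assms(2-4) fin by (subst card_Diff_subset) auto
  then show ?thesis using that by (auto simp: card_1_singleton_iff)
qed

lemma lowest_exists:
  assumes "A \<subseteq> C" "A \<noteq> {}"
  shows "\<exists>c\<in>A. \<forall>d\<in>A - {c}. f (Inl c) < f (Inl d)"
proof -
  have "finite A" using assms(1) fin finite_subset by auto
  then have c: "arg_min_on (\<lambda>c. f (Inl c)) A \<in> A"
      "\<And>d. d \<in> A \<Longrightarrow> f (Inl (arg_min_on (\<lambda>c. f (Inl c)) A)) \<le> f (Inl d)"
    using assms(2) by (rule arg_min_if_finite(1), intro arg_min_least)
  show ?thesis
  proof (intro bexI[OF _ c(1)] ballI)
    fix d assume d: "d \<in> A - {arg_min_on (\<lambda>c. f (Inl c)) A}"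
    then have "f (Inl (arg_min_on (\<lambda>c. f (Inl c)) A)) \<noteq> f (Inl d)"
      using c(1) assms(1) by (intro two_spokes_constraints(1)) auto
    then show "f (Inl (arg_min_on (\<lambda>c. f (Inl c)) A)) < f (Inl d)"
      using c(2)[of d] d by simp
  qed
qed

end

text \<open>
  Let \<open>p\<close> and \<open>q\<close> be the two lowest clique vertices, \<open>t\<close> the label that the clique misses, and
  \<open>j\<close> the clique vertex that shares its label with the hub. Then the hub is below \<open>t\<close>, which rules out a
  second middle vertex with label \<open>t\<close>. For \<open>j = p\<close>, this leaves the label of \<open>p\<close> for the middle of \<open>q\<close>,
  which is adjacent to the hub. For \<open>j \<noteq> p\<close>, the middle of \<open>j\<close> must exceed the clique vertex \<open>j\<close>
  and so has label \<open>t\<close>.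
\<close>

lemma no_ranking_with_card_V_labels:
  assumes n: "card V = n" "n \<ge> 3"
  shows "\<not> is_ranking H n f"
proof
  assume f: "is_ranking H n f"
  let ?a = "\<lambda>c. f (Inl c)" and ?m = "\<lambda>c. f (mid c)"
  have range: "f z \<in> {1..n}" if "z \<in> verts H" for z using f that by (simp add: is_ranking_def)
  have L: "f hub \<in> {1..n}" "\<And>c. c \<in> C \<Longrightarrow> ?a c \<in> {1..n}" "\<And>c. c \<in> C \<Longrightarrow> ?m c \<in> {1..n}"
    by (rule range, simp add: verts_H)+
  obtain t where t: "{1..n} - ?a ` C = {t}"
    using obtain_missing_label[OF f n(1), of "{1..n}"] L by auto
  have card: "card C \<ge> 2" using n fin v by simp
  have "C \<noteq> {}" using card by force
  obtain p where p: "p \<in> C" "\<forall>d\<in>C - {p}. ?a p < ?a d"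
    using lowest_exists[OF f subset_refl \<open>C \<noteq> {}\<close>] by blast
  have "card (C - {p}) \<ge> 1" using card p(1) fin by simp
  then have "C - {p} \<noteq> {}" by force
  obtain q where q: "q \<in> C - {p}" "\<forall>d\<in>C - {p} - {q}. ?a q < ?a d"
    using lowest_exists[OF f Diff_subset \<open>C - {p} \<noteq> {}\<close>] by blast
  have below: "\<exists>d\<in>C. ?m c = ?a d \<and> ?a d < ?a c" if "c \<in> C" "?m c \<noteq> t" for c
    by (rule mid_label_below[OF f t that(1) L(3)[OF that(1)] that(2)])
  have mp: "?m p = t"
  proof (rule ccontr)
    assume "?m p \<noteq> t"
    then obtain d where "d \<in> C" "?a d < ?a p" using below[OF p(1)] by blast
    then show False using p(2)[rule_format, of d] by (cases "d = p") auto
  qed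
  have mq: "?m q = ?a p" if "?m q \<noteq> t"
  proof -
    have "q \<in> C" using q(1) by simp
    from below[OF this that] obtain d where d: "d \<in> C" "?m q = ?a d" "?a d < ?a q" by blast
    then have "d = p" using q(2)[rule_format, of d] by (cases "d = q"; cases "d = p") auto
    then show ?thesis using d by simp
  qed
  have hub_t: "f hub > t" if "j \<in> C" "j \<noteq> p" "?m j = t" for j
    using two_spokes_constraints(4)[OF f p(1) that(1)] that mp by simp
  have "f hub \<noteq> t" using spoke_constraints(2)[OF f p(1)] mp by simp
  then obtain j where j: "j \<in> C" "f hub = ?a j" using t L(1) by blast
  show False
  proof (cases "j = p")
    case True
    then have "f hub < t" using spoke_constraints(3)[OF f p(1)] j mp by simp
    then have "?m q \<noteq> t" using hub_t[of q] q(1) by auto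
    then show False using mq spoke_constraints(2)[OF f, of q] q(1) j True by simp
  next
    case False
    then have "?a p < f hub" using p(2) j by simp
    then have "f hub < t"
      using two_spokes_constraints(3)[OF f p(1) j(1)] False j(2) mp by auto
    moreover have "?m j = t"
    proof (rule ccontr)
      assume "?m j \<noteq> t"
      then have "?m j < ?a j" using below[OF j(1)] by auto
      then show False using spoke_constraints(3)[OF f j(1)] j(2) by simp
    qed
    ultimately show False using hub_t[of j] j(1) False by simp
  qed
qed

text \<open>
  A hub with label 1 separates nothing, so the middle vertices have distinct labels, and the lowest
  three clique vertices determine the labels of their middles one after the other.
\<close>

lemma hub_not_only_one:
  assumes n: "card V = n" "n \<ge> 4" and f: "is_ranking H (n + 1) f"
  shows "{x \<in> verts H. f x = 1} \<noteq> {hub}"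
proof
  assume one: "{x \<in> verts H. f x = 1} = {hub}"
  let ?a = "\<lambda>c. f (Inl c)" and ?m = "\<lambda>c. f (mid c)"
  have range: "f z \<in> {2..n + 1}" if "z \<in> verts H" "z \<noteq> hub" for z
  proof -
    have "f z \<in> {1..n + 1}" "f z \<noteq> 1" using f one that by (auto simp: is_ranking_def)
    then show ?thesis by auto
  qed
  have L: "\<And>c. c \<in> C \<Longrightarrow> ?a c \<in> {2..n + 1}" "\<And>c. c \<in> C \<Longrightarrow> ?m c \<in> {2..n + 1}"
    using range by (simp_all add: verts_H)
  have hub: "f hub = 1" using one by blast
  obtain t where t: "{2..n + 1} - ?a ` C = {t}"
    using obtain_missing_label[OF f n(1), of "{2..n + 1}"] L by auto
  have card: "card C \<ge> 3" using n fin v by simp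
  have "C \<noteq> {}" using card by force
  obtain p where p: "p \<in> C" "\<forall>d\<in>C - {p}. ?a p < ?a d"
    using lowest_exists[OF f subset_refl \<open>C \<noteq> {}\<close>] by blast
  have card1: "card (C - {p}) \<ge> 2" using card p(1) fin by simp
  then have "C - {p} \<noteq> {}" by force
  obtain q where q: "q \<in> C - {p}" "\<forall>d\<in>C - {p} - {q}. ?a q < ?a d"
    using lowest_exists[OF f Diff_subset \<open>C - {p} \<noteq> {}\<close>] by blast
  have "card (C - {p} - {q}) \<ge> 1" using card1 q(1) fin by simp
  then have "C - {p} - {q} \<noteq> {}" by force
  moreover have "C - {p} - {q} \<subseteq> C" by blast
  ultimately obtain r where r: "r \<in> C - {p} - {q}"
      "\<forall>d\<in>C - {p} - {q} - {r}. ?a r < ?a d"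
    using lowest_exists[OF f, of "C - {p} - {q}"] by blast
  have distinct: "?m c \<noteq> ?m d" if "c \<in> C" "d \<in> C" "c \<noteq> d" for c d
    using two_spokes_constraints(4)[OF f that] L(2)[OF that(1)] hub by auto
  have below: "\<exists>d\<in>C. ?m c = ?a d \<and> ?a d < ?a c" if "c \<in> C" "?m c \<noteq> t" for c
    by (rule mid_label_below[OF f t that(1) L(2)[OF that(1)] that(2)])
  have mp: "?m p = t"
  proof (rule ccontr)
    assume "?m p \<noteq> t"
    then obtain d where "d \<in> C" "?a d < ?a p" using below[OF p(1)] by blast
    then show False using p(2)[rule_format, of d] by (cases "d = p") auto
  qed
  have C: "q \<in> C" "r \<in> C" "q \<noteq> p" "r \<noteq> p" "r \<noteq> q" using q(1) r(1) by auto
  have mq: "?m q = ?a p"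
  proof -
    have "?m q \<noteq> t" using distinct[of p q] mp p(1) C by simp
    from below[OF C(1) this] obtain d where d: "d \<in> C" "?m q = ?a d" "?a d < ?a q" by blast
    then have "d = p" using q(2)[rule_format, of d] by (cases "d = q"; cases "d = p") auto
    then show ?thesis using d by simp
  qed
  have mr: "?m r = ?a q"
  proof -
    have "?m r \<noteq> t" using distinct[of p r] mp p(1) C by simp
    from below[OF C(2) this] obtain d where d: "d \<in> C" "?m r = ?a d" "?a d < ?a r" by blast
    have "d \<noteq> p" using d mq distinct[of r q] C by auto
    then have "d = q" using d r(2)[rule_format, of d] by (cases "d = r"; cases "d = q") auto
    then show ?thesis using d by simp
  qed
  have "?a p < ?a q" using p(2) C by simp
  then show False
    using two_spokes_constraints(5)[OF f C(1,2)] C(5) mq mr hub L(1)[OF C(1)] by auto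
qed


section \<open>Criticality and 1-uniqueness\<close>

lemma C_nonempty:
  assumes "card V = n" "n \<ge> 3"
  shows "C \<noteq> {}"
proof
  assume "C = {}"
  then have "V = {v}" using v by blast
  then show False using assms by simp
qed

lemma tree_depth_H:
  assumes "card V = n" "n \<ge> 3"
  shows "tree_depth H = n + 1"
  unfolding tree_depth_def
proof (rule Least_equality)
  have "C \<noteq> {}" using C_nonempty[OF assms] .
  then show "\<exists>f. is_ranking H (n + 1) f"
    using only_mid_labelled_one[OF _ assms(1)] by blast
next
  fix k assume "\<exists>f. is_ranking H k f"
  then obtain f where "is_ranking H k f" ..
  then have "\<not> k \<le> n" using is_ranking_mono_labels no_ranking_with_card_V_labels[OF assms] by blast
  then show "n + 1 \<le> k" by simp
qed

lemma minor_rankings_edge: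
  assumes "card V = n" "n \<ge> 3" and e: "{x, y} \<in> edges H"
  shows "\<exists>f. is_ranking (delete_edge H {x, y}) n f"
    and "\<exists>f. is_ranking (contract_edge H x y) n f"
proof -
  have D: "(\<exists>f. is_ranking (delete_edge H {x, y}) n f) \<and>
      (\<exists>f. is_ranking (contract_edge H x y) n f)"
    if xy: "{x, y} = {p, q}" and pq: "\<exists>f. is_ranking (delete_edge H {p, q}) n f \<and>
      is_ranking (contract_edge H p q) n f \<and> is_ranking (contract_edge H q p) n f" for p q
  proof -
    have "x = p \<and> y = q \<or> x = q \<and> y = p" using xy by (auto simp: doubleton_eq_iff)
    then show ?thesis using pq xy by metis
  qed
  have "(\<exists>f. is_ranking (delete_edge H {x, y}) n f) \<and>
      (\<exists>f. is_ranking (contract_edge H x y) n f)"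
    using e
  proof (cases rule: edges_H_cases)
    case (1 c)
    then show ?thesis using D minor_rankings_hub_mid[OF 1(1) assms(1,2)] by blast
  next
    case (2 c)
    then show ?thesis using D minor_rankings_mid_clique[OF 2(1) assms(1,2)] by blast
  next
    case (3 c d)
    then show ?thesis using D minor_rankings_clique_clique[of c d, OF _ assms(1,2)] by blast
  qed
  then show "\<exists>f. is_ranking (delete_edge H {x, y}) n f"
    "\<exists>f. is_ranking (contract_edge H x y) n f" by blast+
qed

text \<open>
  Deleting a vertex also deletes an edge, because no vertex of \<open>H\<close> is isolated.
\<close>

lemma minor_step_H_ranking:
  assumes n: "card V = n" "n \<ge> 3" and M: "minor_step H M"
  shows "\<exists>f. is_ranking M n f"
  using M
proof cases
  case (vertex_deletion x)
  have "\<exists>y. {x, y} \<in> edges H"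
    using vertex_deletion(2)
  proof (cases rule: verts_H_cases)
    case 1
    have "C \<noteq> {}" using C_nonempty[OF n] .
    then show ?thesis using neighbour_mid[of _ hub] 1 by blast
  next
    case (2 c)
    then show ?thesis using neighbour_mid[of c x] by blast
  next
    case (3 c)
    then show ?thesis using neighbour_clique[of c x] by blast
  qed
  then obtain y where "{x, y} \<in> edges H" ..
  from minor_rankings_edge(1)[OF n this] obtain f where
    f: "is_ranking (delete_edge H {x, y}) n f" ..
  have "is_ranking M n f"
    unfolding vertex_deletion(1)
    by (rule is_ranking_subgraph[OF f]) (auto simp: delete_vertex_def delete_edge_def)
  then show ?thesis by (rule exI[of _ f])
next
  case (edge_deletion e)
  have "card e = 2" using simple_H edge_deletion(2) by (auto simp: simple_graph_def)
  then obtain x y where "e = {x, y}" by (auto simp: card_2_iff)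
  then show ?thesis using minor_rankings_edge(1)[OF n] edge_deletion by blast
next
  case (edge_contraction x y)
  then show ?thesis using minor_rankings_edge(2)[OF n] by blast
qed

lemma k_critical_H:
  assumes "card V = n" "n \<ge> 3"
  shows "k_critical (n + 1) H"
proof -
  have "tree_depth M < tree_depth H" if "proper_minor M H" for M
  proof -
    have "\<exists>f. is_ranking M n f"
      using that simple_H minor_step_H_ranking[OF assms] by (rule proper_minor_rankingI)
    then have "tree_depth M \<le> n" unfolding tree_depth_def by (rule Least_le)
    then show ?thesis using tree_depth_H[OF assms] by simp
  qed
  then show ?thesis using tree_depth_H[OF assms] by (simp add: k_critical_def critical_def)
qed

lemma one_unique_vertex_H_iff:
  assumes n: "card V = n" "n \<ge> 4" and u: "u \<in> verts H"
  shows "one_unique_vertex H u \<longleftrightarrow> u \<noteq> hub"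
proof -
  have td: "tree_depth H = n + 1" using tree_depth_H n by simp
  have "\<not> one_unique_vertex H hub"
    unfolding one_unique_vertex_def optimal_ranking_def td using hub_not_only_one[OF n] by blast
  moreover have "one_unique_vertex H u" if "u \<noteq> hub"
    using u
  proof (cases rule: verts_H_cases)
    case (2 c)
    then show ?thesis unfolding one_unique_vertex_def optimal_ranking_def td
      using u only_clique_vertex_labelled_one[OF 2(1) n(1)] by simp
  next
    case (3 c)
    then show ?thesis unfolding one_unique_vertex_def optimal_ranking_def td
      using u only_mid_labelled_one[OF 3(1) n(1)] by simp
  qed (use that in simp)
  ultimately show ?thesis by blast
qed

end

theorem theorem4:
  fixes n :: nat and V :: "'a set" and v :: 'a
  assumes "n \<ge> 4"
    and "finite V" and "card V = n"
    and "v \<in> V"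
  shows "k_critical (n + 1) (subdivide_at (complete_graph V) v)
       \<and> \<not> one_unique (subdivide_at (complete_graph V) v)
       \<and> {u \<in> verts (subdivide_at (complete_graph V) v).
            \<not> one_unique_vertex (subdivide_at (complete_graph V) v) u} = {Inl v}"
proof -
  let ?H = "subdivide_at (complete_graph V) v"
  have v: "Inl v \<in> verts ?H" using verts_H[OF assms(2,4)] by simp
  have iff: "one_unique_vertex ?H u \<longleftrightarrow> u \<noteq> Inl v" if "u \<in> verts ?H" for u
    using one_unique_vertex_H_iff[OF assms(2,4,3,1) that] .
  have "k_critical (n + 1) ?H" using k_critical_H[OF assms(2,4,3)] assms(1) by simp
  moreover have "\<not> one_unique ?H" using v iff by (auto simp: one_unique_def)
  moreover have "{u \<in> verts ?H. \<not> one_unique_vertex ?H u} = {Inl v}" using v iff by auto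
  ultimately show ?thesis by blast
qed

end
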